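(* The number $\frac{12}{25}$ is not a jump for $r=3$.
   Context: An $r$-uniform graph $G$ is a finite set $V(G)$ of vertices together with a set $E(G)\subseteq\binom{V(G)}{r}$ of edges, where $\binom{V}{r}$ denotes the family of all $r$-subsets of $V$. Its density is $d(G)=|E(G)|/\binom{|V(G)|}{r}$. A real number $\alpha\in[0,1)$ is a jump for an integer $r\ge 2$ if there exists a constant $c>0$ such that for any $\epsilon>0$ and any integer $m\ge r$ there exists an integer $n_0(\epsilon,m)$ such that any $r$-uniform graph with $n>n_0(\epsilon,m)$ vertices and density $\ge\alpha+\epsilon$ contains a subgraph with $m$ vertices and density $\ge\alpha+c$. A number in $[0,1)$ that is not a jump for $r$ is called a non-jump for $r$. *)

theory Defs
  imports Complex_Main
begin

record 'a hypergraph =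
  verts :: "'a set"
  edges :: "'a set set"

definition uniform_graph :: "nat \<Rightarrow> 'a hypergraph \<Rightarrow> bool" where
  "uniform_graph r G \<longleftrightarrow>
     finite (verts G) \<and> edges G \<subseteq> {e. e \<subseteq> verts G \<and> card e = r}"

definition density :: "nat \<Rightarrow> 'a hypergraph \<Rightarrow> real" where
  "density r G = real (card (edges G)) / real (card (verts G) choose r)"

text \<open>Subgraphs need not be induced.\<close>

definition subgraph :: "nat \<Rightarrow> 'a hypergraph \<Rightarrow> 'a hypergraph \<Rightarrow> bool" where
  "subgraph r H G \<longleftrightarrow>
     uniform_graph r H \<and> verts H \<subseteq> verts G \<and> edges H \<subseteq> edges G"

text \<open>
  HOL cannot quantify over types inside a definition, so the graphs range over those whose
  vertices are natural numbers. Every finite graph is isomorphic to one of these, and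
  density and the existence of subgraphs of a given order and density are invariant
  under isomorphism.
\<close>

definition jump :: "nat \<Rightarrow> real \<Rightarrow> bool" where
  "jump r \<alpha> \<longleftrightarrow>
     2 \<le> r \<and> 0 \<le> \<alpha> \<and> \<alpha> < 1 \<and>
     (\<exists>c>0. \<forall>\<epsilon>>0. \<forall>m\<ge>r. \<exists>n0::nat. \<forall>G :: nat hypergraph.
        uniform_graph r G \<and> card (verts G) > n0 \<and> density r G \<ge> \<alpha> + \<epsilon> \<longrightarrow>
        (\<exists>H. subgraph r H G \<and> card (verts H) = m \<and> density r H \<ge> \<alpha> + c))"

end

theory Submission
  imports Defs "HOL-Library.Ramsey"
begin

text \<open>
  The proof follows the method of Frankl and Roedl. Suppose that for every \<open>m\<close> there is a
  3-graph \<open>F\<close> on \<open>N\<close> vertices which is globally too dense, in that it has more than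
  \<open>(2/25) N\<^sup>3\<close> edges, but locally looks no denser than 12/25: for every weighting \<open>x\<close> of its
  vertices by natural numbers of total \<open>m\<close>, the sum of \<open>x u * x v * x w\<close> over the edges is at
  most \<open>(2/25) m\<^sup>3\<close>. Blowing every vertex of \<open>F\<close> up into \<open>q\<close> copies gives arbitrarily large
  graphs whose density exceeds \<open>12/25\<close> by a constant that depends on \<open>F\<close> only. An \<open>m\<close>-vertex
  subgraph of the blow-up takes \<open>x v\<close> copies of the vertex \<open>v\<close> for some weighting \<open>x\<close>, so it has
  at most \<open>(2/25) m\<^sup>3\<close> edges, and for large \<open>m\<close> its density is below \<open>12/25 + c\<close>. This is
  \<open>not_jump_3_criterion\<close>.

  To construct \<open>F\<close>, split the vertices into parts \<open>A\<close>, \<open>B\<close>, \<open>C\<close> in proportion 2:2:1 and take all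
  triples of the types \<open>AAB\<close>, \<open>ABC\<close> and \<open>BBC\<close>. If the parts carry weights \<open>a\<close>, \<open>b\<close>, \<open>c\<close>, the
  leading term of the edge sum is \<open>a\<^sup>2 b / 2 + a b c + b\<^sup>2 c / 2\<close>, whose maximum over
  \<open>a + b + c = 1\<close> is \<open>2/25\<close>, attained at \<open>(2/5, 2/5, 1/5)\<close>. Edges cannot use a vertex
  twice, so the number of edges stays below \<open>(2/25) N\<^sup>3\<close> by a quantity of order \<open>N\<^sup>2\<close>. The
  deficit is overcome by adding a triple system \<open>E\<close> inside \<open>A\<close> with at least \<open>card A ^ 2\<close> triples
  in which any \<open>k \<le> m\<close> vertices span at most \<open>k - 2\<close> triples. It exists by the deletion method
  (\<open>sparse_triples_exist\<close>).

  It remains to see that \<open>E\<close> does no harm locally. By sparseness, the triples of \<open>E\<close> that meet a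
  weighting of total \<open>m\<close> contribute no more than if all of them contained the two
  heaviest vertices of \<open>A\<close>, of weights \<open>u\<close> and \<open>v\<close>: at most \<open>u v (a - u - v)\<close>
  (\<open>edge_sum_locally_sparse_le\<close>). On the other hand no \<open>AAB\<close> edge uses either of these
  two vertices twice, which lowers the edge sum of the pattern below the leading term by at least
  \<open>b (u\<^sup>2 + v\<^sup>2) / 2\<close>, which is at least \<open>b u v\<close>. The net gain is at most \<open>u v (a - b - u - v)\<close>,
  hence at most \<open>(a - b)\<^sup>3 / 27\<close> if \<open>a \<ge> b\<close> and nonpositive otherwise. At the maximum of the
  polynomial \<open>a = b\<close>, and away from it the loss, which is quadratic in the displacement,
  outweighs the cubic gain (\<open>pattern_poly_le\<close>).
\<close>

section \<open>Locally sparse triple systems\<close>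

text \<open>
  The inequality holds on average over a random \<open>S\<close> that contains each element of \<open>U\<close>
  independently with probability \<open>p\<close>, when \<open>card S\<close> is diminished by the number of sets \<open>B i\<close>
  inside \<open>S\<close>: the expected size is \<open>p * card U\<close>, and \<open>B i\<close> survives with probability
  \<open>p ^ card (B i)\<close>. Removing one element from every surviving \<open>B i\<close> makes a good choice of \<open>S\<close>
  independent. The weights \<open>w\<close> in the proof are the probabilities of the subsets.
\<close>
lemma deletion_method:
  fixes B :: "'i \<Rightarrow> 'a set" and p :: real
  assumes U: "finite U" and I: "finite I"
    and B: "\<And>i. i \<in> I \<Longrightarrow> B i \<subseteq> U" "\<And>i. i \<in> I \<Longrightarrow> B i \<noteq> {}"
    and p: "0 \<le> p" "p \<le> 1"
  obtains S where "S \<subseteq> U" "\<And>i. i \<in> I \<Longrightarrow> \<not> B i \<subseteq> S"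
    and "p * card U - (\<Sum>i\<in>I. p ^ card (B i)) \<le> card S"
proof -
  define w where "w S = p ^ card S * (1 - p) ^ card (U - S)" for S
  define bad where "bad S = {i \<in> I. B i \<subseteq> S}" for S
  have w_nonneg: "0 \<le> w S" for S using p by (simp add: w_def)
  \<comment> \<open>The probability that \<open>S\<close> contains \<open>X\<close>: in the expansion of the product of the sums \<open>p + g a\<close>, the zeros
    of \<open>g\<close> on \<open>X\<close> cancel exactly the terms of the sets that miss a point of \<open>X\<close>.\<close>
  have contains: "(\<Sum>S\<in>Pow U. w S * of_bool (X \<subseteq> S)) = p ^ card X" if X: "X \<subseteq> U" for X
  proof -
    define g where "g a = (if a \<in> X then 0 else 1 - p)" for a
    have fX: "finite X" using U X finite_subset by auto
    have "(\<Prod>a\<in>U - S. g a) = (1 - p) ^ card (U - S) * of_bool (X \<subseteq> S)" if S: "S \<in> Pow U" for S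
    proof (cases "X \<subseteq> S")
      case True
      then have "(\<Prod>a\<in>U - S. g a) = (\<Prod>a\<in>U - S. 1 - p)"
        by (intro prod.cong) (auto simp: g_def)
      then show ?thesis using True by simp
    next
      case False
      then obtain a where "a \<in> X" "a \<notin> S" by auto
      then have "(\<Prod>a\<in>U - S. g a) = 0" using X U by (intro prod_zero) (auto simp: g_def)
      then show ?thesis using False by simp
    qed
    then have "(\<Sum>S\<in>Pow U. w S * of_bool (X \<subseteq> S)) = (\<Sum>S\<in>Pow U. (\<Prod>a\<in>S. p) * (\<Prod>a\<in>U - S. g a))"
      by (intro sum.cong) (auto simp: w_def)
    also have "\<dots> = (\<Prod>a\<in>U. p + g a)" using prod_add[OF U, of "\<lambda>_. p" g] by simp
    also have "\<dots> = (\<Prod>a\<in>X. p + g a) * (\<Prod>a\<in>U - X. p + g a)"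
      using prod.subset_diff[OF X U] by (simp add: mult.commute)
    also have "\<dots> = p ^ card X" by (simp add: g_def)
    finally show ?thesis .
  qed
  have total: "(\<Sum>S\<in>Pow U. w S) = 1" using contains[of "{}"] by simp
  have size: "(\<Sum>S\<in>Pow U. w S * card S) = p * card U"
  proof -
    have "(\<Sum>S\<in>Pow U. w S * card S) = (\<Sum>S\<in>Pow U. \<Sum>a\<in>U. w S * of_bool ({a} \<subseteq> S))"
    proof (intro sum.cong refl)
      fix S assume "S \<in> Pow U"
      then have "U \<inter> S = S" by auto
      then have "real (card S) = (\<Sum>a\<in>U. of_bool ({a} \<subseteq> S))"
        using U by (simp add: of_bool_def sum.If_cases Int_def[symmetric])
      then show "w S * card S = (\<Sum>a\<in>U. w S * of_bool ({a} \<subseteq> S))"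
        by (simp add: sum_distrib_left)
    qed
    also have "\<dots> = (\<Sum>a\<in>U. \<Sum>S\<in>Pow U. w S * of_bool ({a} \<subseteq> S))" by (rule sum.swap)
    also have "\<dots> = (\<Sum>a\<in>U. p)" by (intro sum.cong refl, subst contains) auto
    finally show ?thesis by (simp add: mult.commute)
  qed
  have bads: "(\<Sum>S\<in>Pow U. w S * card (bad S)) = (\<Sum>i\<in>I. p ^ card (B i))"
  proof -
    have "(\<Sum>S\<in>Pow U. w S * card (bad S)) = (\<Sum>S\<in>Pow U. \<Sum>i\<in>I. w S * of_bool (B i \<subseteq> S))"
      using I by (simp add: bad_def sum_distrib_left[symmetric] Int_def)
    also have "\<dots> = (\<Sum>i\<in>I. \<Sum>S\<in>Pow U. w S * of_bool (B i \<subseteq> S))" by (rule sum.swap)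
    also have "\<dots> = (\<Sum>i\<in>I. p ^ card (B i))" using contains B(1) by simp
    finally show ?thesis .
  qed
  let ?E = "p * card U - (\<Sum>i\<in>I. p ^ card (B i))"
  have "\<exists>S\<in>Pow U. ?E \<le> real (card S) - card (bad S)"
  proof (rule ccontr)
    assume none: "\<not> ?thesis"
    have neg: "real (card S) - card (bad S) < ?E" if "S \<in> Pow U" for S
      using that none by (meson not_le)
    obtain S0 where S0: "S0 \<in> Pow U" "w S0 \<noteq> 0" using total by (metis sum.neutral zero_neq_one)
    have "(\<Sum>S\<in>Pow U. w S * (real (card S) - card (bad S))) < (\<Sum>S\<in>Pow U. w S * ?E)"
    proof (rule sum_strict_mono_ex1)
      show "finite (Pow U)" using U by simp
      show "\<forall>S\<in>Pow U. w S * (real (card S) - card (bad S)) \<le> w S * ?E"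
        using mult_left_mono[OF less_imp_le[OF neg] w_nonneg] by blast
      have "0 < w S0" using S0(2) w_nonneg[of S0] by linarith
      then show "\<exists>S\<in>Pow U. w S * (real (card S) - card (bad S)) < w S * ?E"
        using S0(1) neg[OF S0(1)] by (intro bexI[of _ S0] mult_strict_left_mono) auto
    qed
    also have "\<dots> = ?E" using total by (simp add: sum_distrib_right[symmetric])
    also have "(\<Sum>S\<in>Pow U. w S * (real (card S) - card (bad S))) = ?E"
      using size bads by (simp add: right_diff_distrib sum_subtractf)
    finally show False by simp
  qed
  then obtain S where S: "S \<subseteq> U" "?E \<le> real (card S) - card (bad S)" by auto
  define pick where "pick i = (SOME a. a \<in> B i)" for i
  have pick: "pick i \<in> B i" if "i \<in> I" for i using B(2)[OF that] by (simp add: pick_def some_in_eq)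
  define S' where "S' = S - pick ` bad S"
  have "card S \<le> card (S' \<union> pick ` bad S)"
    using S(1) U I by (intro card_mono) (auto simp: S'_def bad_def finite_subset)
  also have "\<dots> \<le> card S' + card (pick ` bad S)" by (rule card_Un_le)
  also have "\<dots> \<le> card S' + card (bad S)" using I by (simp add: bad_def card_image_le)
  finally have "?E \<le> card S'" using S(2) by linarith
  moreover have "\<not> B i \<subseteq> S'" if "i \<in> I" for i
    using pick[OF that] that unfolding S'_def bad_def by blast
  ultimately show ?thesis using S(1) by (intro that[of S']) (auto simp: S'_def)
qed

text \<open>
  For \<open>card K < 2\<close> the truncated difference is 0, which is correct for systems of triples. The
  bound \<open>card K - 2\<close> is the one that a system of triples through a common pair attains, so pairs may
  have large degree. Partial Steiner systems would be too small for the construction.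
\<close>
definition locally_sparse :: "nat \<Rightarrow> 'a set set \<Rightarrow> bool" where
  "locally_sparse m E \<longleftrightarrow>
     (\<forall>K. finite K \<and> card K \<le> m \<longrightarrow> card {e \<in> E. e \<subseteq> K} \<le> card K - 2)"

lemma real_choose_3: "real (n choose 3) = real n * (real n - 1) * (real n - 2) / 6"
proof (induction n)
  case (Suc n)
  have "real (n choose 2) = real n * (real n - 1) / 2"
    by (induction n) (auto simp: numeral_2_eq_2 field_simps)
  then show ?case using Suc by (simp add: numeral_3_eq_3 numeral_2_eq_2 field_simps)
qed simp

text \<open>
  Choose triples with probability \<open>p = D / n\<close>. About \<open>D n\<^sup>2 / 6\<close> triples are expected, which exceeds
  \<open>C n\<^sup>2\<close> for \<open>D = 6 (C + 1)\<close>. A set of \<open>k\<close> vertices is an obstacle if it spans some \<open>k - 1\<close> chosen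
  triples; there are at most \<open>n ^ k\<close> such sets, each with a bounded number of systems of \<open>k - 1\<close>
  triples, so the expected number of obstacles is of order \<open>n ^ k * p ^ (k - 1)\<close>, which is
  linear in \<open>n\<close>. Deleting them costs little.
\<close>
lemma sparse_triples_exist:
  fixes C :: real
  assumes C: "0 \<le> C"
  shows "\<exists>n0. \<forall>n\<ge>n0. \<exists>E \<subseteq> nsets {..<n::nat} 3. locally_sparse m E \<and> C * n\<^sup>2 \<le> card E"
proof -
  define D :: real where "D = 6 * (C + 1)"
  define M :: real where "M = 2 ^ 2 ^ m"
  define Q where "Q = M * (real m + 1) * D ^ m"
  have D: "1 \<le> D" using C by (simp add: D_def)
  define n0 where "n0 = nat \<lceil>3 * C + 3 + Q + D\<rceil>"
  have "\<exists>E \<subseteq> nsets {..<n} 3. locally_sparse m E \<and> C * n\<^sup>2 \<le> card E" if n: "n0 \<le> n" for n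
  proof -
    have Q0: "0 \<le> Q" using D by (simp add: Q_def M_def)
    have nC: "3 * C + 3 + Q + D \<le> n" using n unfolding n0_def by linarith
    have n1: "D \<le> n" "1 \<le> n" "3 \<le> n" using nC Q0 C D by linarith+
    define p where "p = D / n"
    have p: "0 \<le> p" "p \<le> 1" using n1 D by (auto simp: p_def)
    define U where "U = nsets {..<n} 3"
    have finU: "finite U" by (simp add: U_def finite_imp_finite_nsets)
    \<comment> \<open>The obstacles are indexed by pairs, a vertex set \<open>K\<close> and a system of \<open>card K - 1\<close> triples on it.\<close>
    define \<K> where "\<K> = {K. K \<subseteq> {..<n} \<and> 3 \<le> card K \<and> card K \<le> m}"
    define I where "I = (SIGMA K:\<K>. nsets (nsets K 3) (card K - 1))"
    have fin\<K>: "finite \<K>" by (rule finite_subset[of _ "Pow {..<n}"]) (auto simp: \<K>_def)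
    have finK: "finite K" if "K \<in> \<K>" for K using that finite_subset by (auto simp: \<K>_def)
    have finI: "finite I" unfolding I_def
      using fin\<K> finK by (intro finite_SigmaI) (auto simp: finite_imp_finite_nsets)
    have sub: "snd i \<subseteq> U" "snd i \<noteq> {}" if i: "i \<in> I" for i
    proof -
      obtain K B where KB: "i = (K, B)" "K \<in> \<K>" "B \<in> nsets (nsets K 3) (card K - 1)"
        using i unfolding I_def by blast
      have "nsets K 3 \<subseteq> U" using KB(2) unfolding U_def \<K>_def by (intro nsets_mono) simp
      moreover have "B \<subseteq> nsets K 3" "card B = card K - 1" using KB(3) by (simp_all add: nsets_def)
      ultimately show "snd i \<subseteq> U" "snd i \<noteq> {}" using KB(1,2) by (auto simp: \<K>_def)
    qed
    obtain S where S: "S \<subseteq> U" "\<And>i. i \<in> I \<Longrightarrow> \<not> snd i \<subseteq> S"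
      and Scard: "p * card U - (\<Sum>i\<in>I. p ^ card (snd i)) \<le> card S"
      using deletion_method[OF finU finI, of snd p] sub p by auto
    have bad: "(\<Sum>i\<in>I. p ^ card (snd i)) \<le> Q * n"
    proof -
      have "(\<Sum>i\<in>I. p ^ card (snd i)) = (\<Sum>K\<in>\<K>. \<Sum>B\<in>nsets (nsets K 3) (card K - 1). p ^ card B)"
        unfolding I_def using fin\<K> finK
        by (subst sum.Sigma) (auto simp: finite_imp_finite_nsets split_beta)
      also have "\<dots> \<le> (\<Sum>K\<in>\<K>. M * p ^ (card K - 1))"
      proof (rule sum_mono)
        fix K assume K: "K \<in> \<K>"
        have "card (nsets (nsets K 3) (card K - 1)) \<le> card (Pow (Pow K))"
          using finK[OF K] by (intro card_mono) (auto simp: nsets_def)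
        also have "\<dots> = 2 ^ 2 ^ card K" using finK[OF K] by (simp add: card_Pow)
        also have "\<dots> \<le> 2 ^ 2 ^ m" using K by (intro power_increasing) (auto simp: \<K>_def)
        finally have "real (card (nsets (nsets K 3) (card K - 1))) \<le> M"
          unfolding M_def by (metis of_nat_le_iff of_nat_numeral of_nat_power)
        then show "(\<Sum>B\<in>nsets (nsets K 3) (card K - 1). p ^ card B) \<le> M * p ^ (card K - 1)"
          using p by (auto simp: nsets_def intro!: mult_right_mono)
      qed
      also have "\<dots> = M * (\<Sum>k\<in>{3..m}. \<Sum>K\<in>{K \<in> \<K>. card K = k}. p ^ (card K - 1))"
        unfolding sum_distrib_left[symmetric]
        by (subst sum.group) (auto simp: fin\<K> \<K>_def)
      also have "\<dots> \<le> M * (\<Sum>k\<in>{3..m}. n * D ^ m)"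
      proof (intro mult_left_mono sum_mono)
        fix k assume k: "k \<in> {3..m}"
        have "{K \<in> \<K>. card K = k} = {K. K \<subseteq> {..<n} \<and> card K = k}"
          using k by (auto simp: \<K>_def)
        then have ck: "card {K \<in> \<K>. card K = k} = n choose k" using n_subsets[of "{..<n}" k] by simp
        have "n choose k \<le> n ^ k"
          by (cases "k \<le> n") (auto simp: binomial_le_pow binomial_eq_0)
        then have le: "real (n choose k) \<le> real n ^ k" by (metis of_nat_le_iff of_nat_power)
        have "(\<Sum>K\<in>{K \<in> \<K>. card K = k}. p ^ (card K - 1)) = (n choose k) * p ^ (k - 1)"
          using ck by simp
        also have "\<dots> \<le> real n ^ k * p ^ (k - 1)" using p le by (intro mult_right_mono) auto
        also have "\<dots> = n * (n * p) ^ (k - 1)"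
          using k by (simp add: power_mult_distrib power_Suc[symmetric] mult.assoc[symmetric] del: power_Suc)
        also have "n * p = D" using n1 by (simp add: p_def)
        also have "n * D ^ (k - 1) \<le> n * D ^ m"
          using k D by (intro mult_left_mono power_increasing) auto
        finally show "(\<Sum>K\<in>{K \<in> \<K>. card K = k}. p ^ (card K - 1)) \<le> n * D ^ m" .
      qed (simp add: M_def)
      also have "\<dots> = M * real (m + 1 - 3) * D ^ m * n" by (simp add: algebra_simps)
      also have "\<dots> \<le> Q * n" unfolding Q_def
        using D by (intro mult_right_mono mult_left_mono) (auto simp: M_def)
      finally show ?thesis .
    qed
    have "real (card U) = real n * (real n - 1) * (real n - 2) / 6"
      unfolding U_def lessThan_atLeast0 binomial_eq_nsets[symmetric] by (rule real_choose_3)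
    then have "p * card U = D * (real n / n) * (real n - 1) * (real n - 2) / 6"
      unfolding p_def by (simp only:) (simp add: mult_ac)
    also have "\<dots> = (C + 1) * (real n - 1) * (real n - 2)" using n1 unfolding D_def by (simp add: field_simps)
    finally have "p * card U = (C + 1) * (real n - 1) * (real n - 2)" .
    moreover have "C * n\<^sup>2 + Q * n \<le> (C + 1) * (real n - 1) * (real n - 2)"
    proof -
      have "(3 * C + 3 + Q) * n \<le> n * real n" using nC D by (intro mult_right_mono) auto
      moreover have "(C + 1) * (real n - 1) * (real n - 2)
          = C * real (n\<^sup>2) + n * real n - (3 * C + 3 + Q) * n + Q * n + (2 * C + 2)"
        by (simp add: power2_eq_square algebra_simps)
      moreover have "X + Y \<le> G" if "T \<le> W" "G = X + W - T + Y + (2 * C + 2)" for T W X Y G :: real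
        using that C by linarith
      ultimately show ?thesis by blast
    qed
    ultimately have "C * n\<^sup>2 \<le> card S" using Scard bad by linarith
    moreover have "locally_sparse m S" unfolding locally_sparse_def
    proof (intro allI impI, rule ccontr)
      fix K assume K: "finite K \<and> card K \<le> m" and many: "\<not> card {e \<in> S. e \<subseteq> K} \<le> card K - 2"
      \<comment> \<open>Points of \<open>K\<close> outside the vertex set are discarded, which keeps the triples inside it and only
        lowers the bound.\<close>
      define K' where "K' = K \<inter> {..<n}"
      have K'le: "card K' \<le> card K" using K by (auto simp: K'_def intro: card_mono)
      have eq: "{e \<in> S. e \<subseteq> K} = {e \<in> S. e \<subseteq> K'}"
        using S(1) by (auto simp: K'_def U_def nsets_def)
      have "{e \<in> S. e \<subseteq> K'} \<noteq> {}" using many eq by (metis card.empty le0)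
      then obtain e where "e \<in> S" "e \<subseteq> K'" by auto
      then have K'3: "3 \<le> card K'" using S(1) K card_mono[of K' e]
        by (auto simp: K'_def U_def nsets_def)
      have "card K' - 1 \<le> card {e \<in> S. e \<subseteq> K'}" using many eq K'le K'3 by simp
      then obtain B where B: "B \<subseteq> {e \<in> S. e \<subseteq> K'}" "card B = card K' - 1" "finite B"
        by (rule obtain_subset_with_card_n)
      have "(K', B) \<in> I"
        using B K K'3 K'le S(1) by (auto simp: I_def \<K>_def K'_def nsets_def U_def)
      then show False using S(2)[of "(K', B)"] B(1) by auto
    qed
    ultimately show ?thesis using S(1) unfolding U_def by blast
  qed
  then show ?thesis by blast
qed

section \<open>Edge sums\<close>

text \<open>
  Up to normalisation this is the polynomial whose maximum over the simplex is the Lagrangian of the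
  hypergraph \<open>E\<close>; it also counts the edges of the blow-up in which vertex \<open>v\<close> has \<open>x v\<close> copies.
\<close>
definition edge_sum :: "'a set set \<Rightarrow> ('a \<Rightarrow> 'b::comm_semiring_1) \<Rightarrow> 'b" where
  "edge_sum E x = (\<Sum>e\<in>E. \<Prod>v\<in>e. x v)"

lemma edge_sum_Un_disjoint:
  "finite X \<Longrightarrow> finite Y \<Longrightarrow> X \<inter> Y = {} \<Longrightarrow> edge_sum (X \<union> Y) x = edge_sum X x + edge_sum Y x"
  by (simp add: edge_sum_def sum.union_disjoint)

lemma of_nat_edge_sum: "of_nat (edge_sum E x) = edge_sum E (\<lambda>v. of_nat (x v))"
  by (simp add: edge_sum_def)

lemma sum_layers:
  fixes f :: "'a \<Rightarrow> nat"
  assumes A: "finite A" and le: "\<And>a. a \<in> A \<Longrightarrow> f a \<le> M"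
  shows "sum f A = (\<Sum>\<tau>\<in>{1..M}. card {a \<in> A. \<tau> \<le> f a})"
proof -
  have "f a = (\<Sum>\<tau>\<in>{1..M}. of_bool (\<tau> \<le> f a))" if "a \<in> A" for a
  proof -
    have "{1..M} \<inter> {\<tau>. \<tau> \<le> f a} = {1..f a}" using le[OF that] by auto
    then show ?thesis by simp
  qed
  then have "sum f A = (\<Sum>a\<in>A. \<Sum>\<tau>\<in>{1..M}. of_bool (\<tau> \<le> f a))" by (intro sum.cong) auto
  also have "\<dots> = (\<Sum>\<tau>\<in>{1..M}. \<Sum>a\<in>A. of_bool (\<tau> \<le> f a))" by (rule sum.swap)
  also have "\<dots> = (\<Sum>\<tau>\<in>{1..M}. card {a \<in> A. \<tau> \<le> f a})"
    using A by (simp add: Int_def)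
  finally show ?thesis .
qed

lemma two_heaviest:
  fixes x :: "'a \<Rightarrow> nat"
  assumes "finite A" "2 \<le> card A"
  obtains u v where "u \<in> A" "v \<in> A" "u \<noteq> v" "\<And>z. z \<in> A \<Longrightarrow> x z \<le> x u"
    "\<And>z. z \<in> A - {u} \<Longrightarrow> x z \<le> x v"
proof -
  have "A \<noteq> {}" using assms by auto
  then obtain u where u: "u \<in> A" "x u = Max (x ` A)"
    using Max_in[of "x ` A"] assms(1) by fastforce
  have "A - {u} \<noteq> {}"
  proof
    assume "A - {u} = {}"
    then have "card A \<le> card {u}" by (intro card_mono) auto
    then show False using assms(2) by simp
  qed
  then obtain v where v: "v \<in> A - {u}" "x v = Max (x ` (A - {u}))"
    using Max_in[of "x ` (A - {u})"] assms(1) by fastforce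
  show ?thesis using u v assms(1) by (intro that[of u v]) auto
qed

text \<open>
  The product over an edge is at most \<open>x u * x v\<close> times its smallest weight \<open>\<mu> e\<close>, so it suffices
  to bound the sum of the smallest weights by the total weight outside \<open>{u, v}\<close>. This is done one
  level \<open>\<tau>\<close> at a time. The edges with \<open>\<mu> e \<ge> \<tau>\<close> are those inside the level set \<open>L \<tau>\<close> of vertices of
  weight at least \<open>\<tau>\<close>. As \<open>\<tau> \<ge> 1\<close>, this set has at most \<open>m\<close> elements, so local sparseness leaves
  at most \<open>card (L \<tau>) - 2\<close> edges, no more than there are vertices in \<open>L \<tau> - {u, v}\<close>.
\<close>
lemma edge_sum_locally_sparse_le:
  fixes x :: "'a \<Rightarrow> nat"
  assumes E: "E \<subseteq> nsets A 3" and sparse: "locally_sparse m E"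
    and A: "finite A" and xm: "sum x A \<le> m"
    and uv: "u \<in> A" "v \<in> A" "u \<noteq> v"
    and u: "\<And>z. z \<in> A \<Longrightarrow> x z \<le> x u" and v: "\<And>z. z \<in> A - {u} \<Longrightarrow> x z \<le> x v"
  shows "edge_sum E x \<le> x u * x v * sum x (A - {u, v})"
proof -
  define \<mu> where "\<mu> e = Min (x ` e)" for e
  have finE: "finite E" using E A finite_imp_finite_nsets finite_subset by metis
  have edge: "e \<subseteq> A" "finite e" "card e = 3" if "e \<in> E" for e using E that by (auto simp: nsets_def)
  have prod_le: "(\<Prod>z\<in>e. x z) \<le> x u * x v * \<mu> e" if e: "e \<in> E" for e
  proof -
    have "e \<noteq> {}" using edge[OF e] by auto
    then obtain p where p: "p \<in> e" "x p = \<mu> e"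
      using Min_in[of "x ` e"] edge[OF e] unfolding \<mu>_def by fastforce
    have "card (e - {p}) = 2" using p edge[OF e] by simp
    then obtain q r where qr: "e - {p} = {q, r}" "q \<noteq> r" by (auto simp: card_2_iff)
    have mem: "q \<in> A" "r \<in> A" using qr edge[OF e] by auto
    have "x q * x r \<le> x u * x v"
    proof (cases "r = u")
      case True
      then show ?thesis using mult_le_mono[OF v[of q] le_refl[of "x u"]] mem qr by (simp add: mult.commute)
    next
      case False
      then show ?thesis using mult_le_mono[OF u[of q] v[of r]] mem by simp
    qed
    moreover have "(\<Prod>z\<in>e. x z) = x p * (x q * x r)"
      using p qr edge[OF e] by (simp add: prod.remove[of e p])
    ultimately show ?thesis using p by (simp add: mult.commute)
  qed
  define M where "M = x u"
  define L where "L \<tau> = {z \<in> A. \<tau> \<le> x z}" for \<tau>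
  have \<mu>_le: "\<tau> \<le> \<mu> e \<longleftrightarrow> e \<subseteq> L \<tau>" if "e \<in> E" for e \<tau>
  proof -
    have "e \<noteq> {}" using edge[OF that] by auto
    then show ?thesis using edge[OF that] by (auto simp: \<mu>_def L_def)
  qed
  have \<mu>_M: "\<mu> e \<le> M" if "e \<in> E" for e
  proof -
    have "e \<noteq> {}" using edge[OF that] by auto
    then obtain z where "z \<in> e" by auto
    then have "\<mu> e \<le> x z" "x z \<le> M"
      using edge[OF that] u by (auto simp: \<mu>_def M_def intro: Min_le)
    then show ?thesis by simp
  qed
  have level: "card {e \<in> E. \<tau> \<le> \<mu> e} \<le> card {z \<in> A - {u, v}. \<tau> \<le> x z}" if \<tau>: "\<tau> \<in> {1..M}" for \<tau>
  proof -
    have finL: "finite (L \<tau>)" using A by (simp add: L_def)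
    have "card (L \<tau>) = (\<Sum>z\<in>L \<tau>. 1)" by simp
    also have "\<dots> \<le> sum x (L \<tau>)" using \<tau> by (intro sum_mono) (auto simp: L_def)
    also have "\<dots> \<le> sum x A" using A by (intro sum_mono2) (auto simp: L_def)
    finally have Lm: "card (L \<tau>) \<le> m" using xm by simp
    have "{e \<in> E. \<tau> \<le> \<mu> e} = {e \<in> E. e \<subseteq> L \<tau>}" using \<mu>_le by auto
    then have "card {e \<in> E. \<tau> \<le> \<mu> e} \<le> card (L \<tau>) - 2"
      using sparse finL Lm unfolding locally_sparse_def by auto
    also have "\<dots> = card (L \<tau>) - card {u, v}" using uv by simp
    also have "\<dots> \<le> card (L \<tau> - {u, v})" by (rule diff_card_le_card_Diff) simp
    also have "L \<tau> - {u, v} = {z \<in> A - {u, v}. \<tau> \<le> x z}" by (auto simp: L_def)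
    finally show ?thesis .
  qed
  have "edge_sum E x \<le> (\<Sum>e\<in>E. x u * x v * \<mu> e)"
    unfolding edge_sum_def by (intro sum_mono prod_le)
  also have "\<dots> = x u * x v * sum \<mu> E" by (simp add: sum_distrib_left)
  also have "sum \<mu> E = (\<Sum>\<tau>\<in>{1..M}. card {e \<in> E. \<tau> \<le> \<mu> e})"
    using finE \<mu>_M by (rule sum_layers)
  also have "\<dots> \<le> (\<Sum>\<tau>\<in>{1..M}. card {z \<in> A - {u, v}. \<tau> \<le> x z})" by (intro sum_mono level)
  also have "\<dots> = sum x (A - {u, v})"
    using A u by (subst sum_layers[of _ _ M]) (auto simp: M_def)
  finally show ?thesis by simp
qed

section \<open>The pattern of triples\<close>

definition join :: "'a set set \<Rightarrow> 'a set set \<Rightarrow> 'a set set" where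
  "join X Y = (\<lambda>(f, g). f \<union> g) ` (X \<times> Y)"

lemma join_subset_Pow: "X \<subseteq> Pow A \<Longrightarrow> Y \<subseteq> Pow B \<Longrightarrow> join X Y \<subseteq> Pow (A \<union> B)"
  by (auto simp: join_def)

lemma edge_sum_join:
  assumes "X \<subseteq> Pow A" "Y \<subseteq> Pow B" "finite A" "finite B" "A \<inter> B = {}"
  shows "edge_sum (join X Y) x = edge_sum X x * edge_sum Y x"
proof -
  have inj: "inj_on (\<lambda>(f, g). f \<union> g) (X \<times> Y)"
  proof (rule inj_on_inverseI)
    fix z assume "z \<in> X \<times> Y"
    then show "(\<lambda>e. (e \<inter> A, e \<inter> B)) ((\<lambda>(f, g). f \<union> g) z) = z"
      using assms(1,2,5) by (cases z) blast
  qed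
  have "(\<Prod>v\<in>f \<union> g. x v) = (\<Prod>v\<in>f. x v) * (\<Prod>v\<in>g. x v)" if "f \<in> X" "g \<in> Y" for f g
  proof (rule prod.union_disjoint)
    have "f \<subseteq> A" "g \<subseteq> B" using that assms by auto
    then show "finite f" "finite g" "f \<inter> g = {}" using assms by (auto intro: finite_subset)
  qed
  then have "edge_sum (join X Y) x = (\<Sum>(f, g)\<in>X \<times> Y. (\<Prod>v\<in>f. x v) * (\<Prod>v\<in>g. x v))"
    unfolding edge_sum_def join_def by (subst sum.reindex[OF inj]) (auto intro!: sum.cong)
  then show ?thesis by (simp add: edge_sum_def sum_product sum.cartesian_product)
qed

lemma nsets_1_eq: "nsets A 1 = (\<lambda>v. {v}) ` A"
  by (auto simp: nsets_def card_1_singleton_iff)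

lemma edge_sum_nsets_1: "edge_sum (nsets A 1) x = sum x A"
  unfolding edge_sum_def nsets_1_eq by (subst sum.reindex) auto

lemma edge_sum_nsets_2:
  fixes x :: "'a \<Rightarrow> real"
  assumes "finite A"
  shows "edge_sum (nsets A 2) x = ((sum x A)\<^sup>2 - (\<Sum>v\<in>A. (x v)\<^sup>2)) / 2"
  using assms
proof (induction A)
  case empty
  then show ?case by (simp add: edge_sum_def nsets_empty_iff)
next
  case (insert z A)
  have dec: "nsets (insert z A) 2 = nsets A 2 \<union> (\<lambda>v. {z, v}) ` A"
    using insert(2) by (auto simp: nsets_2_eq)
  have "edge_sum (nsets (insert z A) 2) x
      = edge_sum (nsets A 2) x + (\<Sum>e\<in>(\<lambda>v. {z, v}) ` A. \<Prod>v\<in>e. x v)"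
    unfolding edge_sum_def dec using insert(1,2)
    by (intro sum.union_disjoint) (auto simp: finite_imp_finite_nsets nsets_def)
  also have "(\<Sum>e\<in>(\<lambda>v. {z, v}) ` A. \<Prod>v\<in>e. x v) = (\<Sum>w\<in>A. \<Prod>v\<in>{z, w}. x v)"
    using insert(2) by (subst sum.reindex) (auto simp: inj_on_def doubleton_eq_iff)
  also have "\<dots> = (\<Sum>w\<in>A. x z * x w)"
  proof (rule sum.cong)
    fix w assume "w \<in> A"
    then have "z \<noteq> w" using insert(2) by auto
    then show "(\<Prod>v\<in>{z, w}. x v) = x z * x w" by simp
  qed simp
  also have "\<dots> = x z * sum x A" by (simp add: sum_distrib_left)
  finally show ?case using insert by (simp add: power2_eq_square field_simps)
qed

definition pattern :: "'a set \<Rightarrow> 'a set \<Rightarrow> 'a set \<Rightarrow> 'a set set" where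
  "pattern A B C = join (nsets A 2) (nsets B 1)
     \<union> (join (nsets A 1) (join (nsets B 1) (nsets C 1)) \<union> join (nsets B 2) (nsets C 1))"

lemma join_nsets:
  assumes "X \<subseteq> nsets A i" "Y \<subseteq> nsets B j" "A \<inter> B = {}"
  shows "join X Y \<subseteq> nsets (A \<union> B) (i + j)"
proof
  fix e assume "e \<in> join X Y"
  then obtain f g where e: "e = f \<union> g" "f \<in> X" "g \<in> Y" by (auto simp: join_def)
  then have f: "f \<subseteq> A" "finite f" "card f = i" and g: "g \<subseteq> B" "finite g" "card g = j"
    using assms by (auto simp: nsets_def)
  then have "f \<inter> g = {}" using assms(3) by blast
  then show "e \<in> nsets (A \<union> B) (i + j)"
    using f g e by (auto simp: nsets_def card_Un_disjoint)
qed

lemma pattern_subset_nsets: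
  assumes "A \<inter> B = {}" "A \<inter> C = {}" "B \<inter> C = {}"
  shows "pattern A B C \<subseteq> nsets (A \<union> B \<union> C) 3"
proof -
  have "join (nsets A 2) (nsets B 1) \<subseteq> nsets (A \<union> B) (2 + 1)"
    by (intro join_nsets) (use assms in auto)
  also have "\<dots> \<subseteq> nsets (A \<union> B \<union> C) 3" by (auto simp: nsets_def)
  finally have 1: "join (nsets A 2) (nsets B 1) \<subseteq> nsets (A \<union> B \<union> C) 3" .
  have "join (nsets A 1) (join (nsets B 1) (nsets C 1)) \<subseteq> nsets (A \<union> (B \<union> C)) (1 + (1 + 1))"
    by (intro join_nsets) (use assms in auto)
  also have "\<dots> \<subseteq> nsets (A \<union> B \<union> C) 3" by (auto simp: nsets_def)
  finally have 2: "join (nsets A 1) (join (nsets B 1) (nsets C 1)) \<subseteq> nsets (A \<union> B \<union> C) 3" .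
  have "join (nsets B 2) (nsets C 1) \<subseteq> nsets (B \<union> C) (2 + 1)"
    by (intro join_nsets) (use assms in auto)
  also have "\<dots> \<subseteq> nsets (A \<union> B \<union> C) 3" by (auto simp: nsets_def)
  finally have 3: "join (nsets B 2) (nsets C 1) \<subseteq> nsets (A \<union> B \<union> C) 3" .
  show ?thesis using 1 2 3 by (simp add: pattern_def)
qed

lemma card_join_Int:
  assumes "e \<in> join X Y" "X \<subseteq> nsets A i" "Y \<subseteq> Pow B" "A \<inter> B = {}"
  shows "card (e \<inter> A) = i"
proof -
  obtain f g where e: "e = f \<union> g" "f \<in> X" "g \<in> Y" using assms(1) by (auto simp: join_def)
  then have "e \<inter> A = f" using assms(2-4) by (fastforce simp: nsets_def)
  then show ?thesis using e assms(2) by (auto simp: nsets_def)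
qed

text \<open>
  The four families are disjoint because their edges meet \<open>A\<close> in 3, 2, 1 and 0 vertices. The sums of
  squares record that a vertex cannot be used twice in an edge; the one over \<open>A\<close> later pays for \<open>E\<close>.
\<close>
lemma edge_sum_pattern:
  fixes x :: "'a \<Rightarrow> real"
  assumes fin: "finite A" "finite B" "finite C"
    and disj: "A \<inter> B = {}" "A \<inter> C = {}" "B \<inter> C = {}"
    and E: "E \<subseteq> nsets A 3"
  shows "edge_sum (E \<union> pattern A B C) x = edge_sum E x
     + ((sum x A)\<^sup>2 - (\<Sum>v\<in>A. (x v)\<^sup>2)) / 2 * sum x B
     + sum x A * sum x B * sum x C
     + ((sum x B)\<^sup>2 - (\<Sum>v\<in>B. (x v)\<^sup>2)) / 2 * sum x C"
proof -
  let ?AAB = "join (nsets A 2) (nsets B 1)"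
  let ?ABC = "join (nsets A 1) (join (nsets B 1) (nsets C 1))"
  let ?BBC = "join (nsets B 2) (nsets C 1)"
  have P: "nsets X k \<subseteq> Pow X" for X :: "'a set" and k by (auto simp: nsets_def)
  have PBC: "join (nsets B 1) (nsets C 1) \<subseteq> Pow (B \<union> C)" by (intro join_subset_Pow P)
  have cE: "card (e \<inter> A) = 3" if "e \<in> E" for e
  proof -
    have "e \<in> nsets A 3" using that E by auto
    then have "e \<inter> A = e" "card e = 3" by (auto simp: nsets_def)
    then show ?thesis by simp
  qed
  have cAAB: "card (e \<inter> A) = 2" if "e \<in> ?AAB" for e
    using that by (rule card_join_Int) (use disj P in auto)
  have cABC: "card (e \<inter> A) = 1" if "e \<in> ?ABC" for e
    using that by (rule card_join_Int[OF _ _ PBC]) (use disj in auto)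
  have cBBC: "card (e \<inter> A) = 0" if "e \<in> ?BBC" for e
  proof -
    have "e \<subseteq> B \<union> C" using that join_subset_Pow[OF P P] by blast
    then have "e \<inter> A = {}" using disj by auto
    then show ?thesis by simp
  qed
  have finP: "finite (pattern A B C)"
    using pattern_subset_nsets[OF disj] fin by (meson finite_UnI finite_imp_finite_nsets finite_subset)
  then have finite: "finite ?AAB" "finite (?ABC \<union> ?BBC)" "finite ?ABC" "finite ?BBC"
    by (auto simp: pattern_def)
  have finE: "finite E" using E fin by (meson finite_imp_finite_nsets finite_subset)
  have "edge_sum (E \<union> pattern A B C) x = edge_sum E x + edge_sum (pattern A B C) x"
    using cE cAAB cABC cBBC
    by (intro edge_sum_Un_disjoint finE finP) (fastforce simp: pattern_def)
  also have "edge_sum (pattern A B C) x = edge_sum ?AAB x + edge_sum (?ABC \<union> ?BBC) x"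
    unfolding pattern_def using cAAB cABC cBBC
    by (intro edge_sum_Un_disjoint finite) fastforce
  also have "edge_sum (?ABC \<union> ?BBC) x = edge_sum ?ABC x + edge_sum ?BBC x"
    using cABC cBBC by (intro edge_sum_Un_disjoint finite) fastforce
  also have "edge_sum ?AAB x = edge_sum (nsets A 2) x * edge_sum (nsets B 1) x"
    using fin disj by (intro edge_sum_join[OF P P]) auto
  also have "edge_sum ?ABC x = edge_sum (nsets A 1) x * edge_sum (join (nsets B 1) (nsets C 1)) x"
    using fin disj by (intro edge_sum_join[OF P PBC]) auto
  also have "edge_sum (join (nsets B 1) (nsets C 1)) x = edge_sum (nsets B 1) x * edge_sum (nsets C 1) x"
    using fin disj by (intro edge_sum_join[OF P P]) auto
  also have "edge_sum ?BBC x = edge_sum (nsets B 2) x * edge_sum (nsets C 1) x"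
    using fin disj by (intro edge_sum_join[OF P P]) auto
  finally show ?thesis unfolding edge_sum_nsets_1 edge_sum_nsets_2[OF fin(1)] edge_sum_nsets_2[OF fin(2)]
    by (simp add: algebra_simps)
qed

section \<open>The polynomial inequality\<close>

text \<open>
  Completing the square in \<open>a\<close> leaves a cubic in \<open>b\<close> with the double root \<open>2/5\<close> and the simple root
  \<open>4/5\<close>. This settles \<open>b \<le> 4/5\<close>; for larger \<open>b\<close> the terms with \<open>a\<close>
  sum to something nonpositive, and \<open>b\<^sup>2 (1 - b) / 2\<close> remains.
\<close>
lemma pattern_poly_scaled:
  fixes a b c :: real
  assumes "0 \<le> a" "0 \<le> b" "0 \<le> c" "a + b + c = 1"
  shows "a\<^sup>2 * b / 2 + b\<^sup>2 * c / 2 + a * b * c \<le> 2 / 25"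
proof -
  have c: "c = 1 - a - b" using assms(4) by simp
  have eq: "2 / 25 - (a\<^sup>2 * b / 2 + b\<^sup>2 * c / 2 + a * b * c)
      = (5/8) * (b - 2/5)\<^sup>2 * (4/5 - b) + b / 2 * (a - 1 + 3 * b / 2)\<^sup>2"
    unfolding c by (simp add: power2_eq_square field_simps)
  show ?thesis
  proof (cases "b \<le> 4/5")
    case True
    then have "0 \<le> (5/8) * (b - 2/5)\<^sup>2 * (4/5 - b) + b / 2 * (a - 1 + 3 * b / 2)\<^sup>2"
      using assms by simp
    then show ?thesis using eq by linarith
  next
    case False
    have 1: "a\<^sup>2 * b / 2 + b\<^sup>2 * c / 2 + a * b * c = b / 2 * (a * (2 - 3 * b - a) + b * (1 - b))"
      unfolding c by (simp add: power2_eq_square field_simps)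
    have "a * (2 - 3 * b - a) \<le> 0" using False assms by (intro mult_nonneg_nonpos) auto
    moreover have "b * (1 - b) \<le> 4/25"
      using mult_nonneg_nonneg[of "b - 4/5" "b - 1/5"] False by (simp add: field_simps)
    ultimately have "b / 2 * (a * (2 - 3 * b - a) + b * (1 - b)) \<le> b / 2 * (4/25)"
      using assms by (intro mult_left_mono) auto
    also have "\<dots> \<le> 2/25" using assms by simp
    finally show ?thesis unfolding 1 .
  qed
qed

text \<open>
  The coordinates \<open>u\<close> and \<open>e\<close> are adapted to the decomposition in the previous proof: \<open>u = 0\<close> is the
  optimal \<open>b\<close>, and \<open>e = 0\<close> is the optimal \<open>a\<close> for given \<open>b\<close>. The slack of the polynomial becomes a
  combination of \<open>u\<^sup>2\<close> and \<open>e\<^sup>2\<close> with nonnegative coefficients, while \<open>a - b = u + e\<close>. The condition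
  \<open>c \<ge> 0\<close> reads \<open>e \<le> (1 - u) / 5\<close>; it keeps the terms in \<open>e\<close> under control when \<open>u\<close> is near 1,
  where the coefficient \<open>1 - u\<close> of \<open>e\<^sup>2\<close> vanishes.
\<close>
lemma pattern_poly_gain_scaled:
  fixes a b c :: real
  assumes "0 \<le> b" "b \<le> a" "0 \<le> c" "a + b + c = 1"
  shows "a\<^sup>2 * b / 2 + b\<^sup>2 * c / 2 + a * b * c + (a - b) ^ 3 / 27 \<le> 2 / 25"
proof -
  define u where "u = 1 - 5 * b / 2"
  define e where "e = a - b - u"
  have b: "b = 2/5 * (1 - u)" and a: "a = 2/5 * (1 - u) + u + e"
    by (simp_all add: u_def e_def)
  have c: "c = 1/5 * (1 - u) - e" using assms(4) unfolding a b by (simp add: field_simps)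
  have u: "u \<le> 1" "0 \<le> u + e" and e: "e \<le> 1/5 * (1 - u)"
    using assms(1,2) assms(3)[unfolded c] by (simp_all add: u_def e_def)
  have eq: "27 * (2 / 25 - (a\<^sup>2 * b / 2 + b\<^sup>2 * c / 2 + a * b * c))
      = 27/25 * (u\<^sup>2 * (1 + u)) + 27/5 * ((1 - u) * e\<^sup>2)"
    unfolding a b c by (simp add: power2_eq_square field_simps)
  have u': "-1/4 \<le> u" using u e by (simp add: field_simps)
  have cube: "(u + e) ^ 3 = u ^ 3 + 3 * u\<^sup>2 * e + 3 * u * e\<^sup>2 + e ^ 3"
    by (simp add: power2_eq_square power3_eq_cube algebra_simps)
  define t where "t = (1 - u) * e\<^sup>2"
  have t: "0 \<le> t" using u by (simp add: t_def)
  have e3: "e ^ 3 \<le> 1/5 * t"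
  proof -
    have "e ^ 3 = e * e\<^sup>2" by (simp add: power2_eq_square power3_eq_cube)
    also have "\<dots> \<le> (1/5 * (1 - u)) * e\<^sup>2" using e by (intro mult_right_mono) auto
    finally show ?thesis by (simp add: t_def)
  qed
  have "(u + e) ^ 3 \<le> 27/25 * (u\<^sup>2 * (1 + u)) + 27/5 * t"
  proof (cases "u \<le> 0")
    case True
    have "(u + e) ^ 3 \<le> e ^ 3" using u True by (intro power_mono) auto
    moreover have "0 \<le> u\<^sup>2 * (1 + u)" using u' by simp
    ultimately show ?thesis using e3 t by linarith
  next
    case False
    have lin: "u\<^sup>2 * (1 + u) = u\<^sup>2 + u ^ 3" by (simp add: power2_eq_square power3_eq_cube algebra_simps)
    have "u\<^sup>2 * e \<le> u\<^sup>2 * (1/5 * (1 - u))" using e by (intro mult_left_mono) auto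
    also have "\<dots> = 1/5 * u\<^sup>2 - 1/5 * u ^ 3"
      by (simp add: power2_eq_square power3_eq_cube field_simps)
    finally have u2: "3 * u\<^sup>2 * e \<le> 3/5 * u\<^sup>2 - 3/5 * u ^ 3" by simp
    have u3: "0 \<le> u ^ 3" "0 \<le> u\<^sup>2" using False by auto
    show ?thesis
    proof (cases "u \<le> 1/2")
      case True
      have "3 * u * e\<^sup>2 \<le> 3 * (1 - u) * e\<^sup>2" using True by (intro mult_right_mono) auto
      then have "3 * u * e\<^sup>2 \<le> 3 * t" unfolding t_def by (simp only: mult.assoc)
      then show ?thesis using cube e3 u2 u3 lin t by linarith
    next
      case half: False
      show ?thesis
      proof (cases "0 \<le> e")
        case True
        have "e\<^sup>2 \<le> (1/10)\<^sup>2" using e half True by (intro power_mono) auto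
        then have "3 * u * e\<^sup>2 \<le> 3 * u * (1/100)" using half
          by (intro mult_left_mono) (auto simp: power2_eq_square)
        moreover have "e ^ 3 \<le> (1/10) ^ 3" using e half True by (intro power_mono) auto
        then have "e ^ 3 \<le> 1/1000" by (simp add: power3_eq_cube)
        moreover have "u * (1/2) \<le> u * u" using half by (intro mult_left_mono) auto
        then have "u * (1/2) \<le> u\<^sup>2" by (simp add: power2_eq_square)
        ultimately show ?thesis using cube u2 u3 lin half t by linarith
      next
        case neg: False
        have "(u + e) ^ 3 \<le> u ^ 3" using u neg by (intro power_mono) auto
        then show ?thesis using u3 lin t by linarith
      qed
    qed
  qed
  moreover have "(a - b) ^ 3 = (u + e) ^ 3" by (simp add: e_def)
  ultimately show ?thesis using eq by (simp add: t_def)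
qed

text \<open>
  Homogeneity reduces this to the simplex. Here \<open>g\<close> stands for the net gain that a sparse system
  inside the first part can contribute.
\<close>
lemma pattern_poly_le:
  fixes a b c g :: real
  assumes "0 \<le> a" "0 \<le> b" "0 \<le> c" and g: "g \<le> (max 0 (a - b)) ^ 3 / 27"
  shows "a\<^sup>2 * b / 2 + b\<^sup>2 * c / 2 + a * b * c + g \<le> 2 / 25 * (a + b + c) ^ 3"
proof (cases "a + b + c = 0")
  case True
  then have "a = 0" "b = 0" "c = 0" using assms by linarith+
  then show ?thesis using g by simp
next
  case False
  define s where "s = a + b + c"
  have s: "s > 0" using False assms by (simp add: s_def)
  define a' b' c' where "a' = a / s" and "b' = b / s" and "c' = c / s"
  have abc: "a = s * a'" "b = s * b'" "c = s * c'" using s by (auto simp: a'_def b'_def c'_def)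
  have nn: "0 \<le> a'" "0 \<le> b'" "0 \<le> c'" using s assms by (auto simp: a'_def b'_def c'_def)
  have one: "a' + b' + c' = 1"
    using s by (simp add: a'_def b'_def c'_def s_def add_divide_distrib[symmetric])
  have max: "max 0 (a - b) = s * max 0 (a' - b')"
    using s by (auto simp: abc max_def right_diff_distrib[symmetric] zero_le_mult_iff)
  have "a'\<^sup>2 * b' / 2 + b'\<^sup>2 * c' / 2 + a' * b' * c' + (max 0 (a' - b')) ^ 3 / 27 \<le> 2 / 25"
    using pattern_poly_scaled[OF nn one] pattern_poly_gain_scaled[OF nn(2) _ nn(3) one]
    by (cases "b' \<le> a'") (auto simp: max_def)
  then have "s ^ 3 * (a'\<^sup>2 * b' / 2 + b'\<^sup>2 * c' / 2 + a' * b' * c' + (max 0 (a' - b')) ^ 3 / 27)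
      \<le> s ^ 3 * (2 / 25)"
    using s by (intro mult_left_mono) auto
  moreover have "s ^ 3 * (a'\<^sup>2 * b' / 2 + b'\<^sup>2 * c' / 2 + a' * b' * c' + M ^ 3 / 27)
      = (s * a')\<^sup>2 * (s * b') / 2 + (s * b')\<^sup>2 * (s * c') / 2 + s * a' * (s * b') * (s * c')
        + (s * M) ^ 3 / 27" for M
    by (simp add: power2_eq_square power3_eq_cube algebra_simps)
  ultimately have "a\<^sup>2 * b / 2 + b\<^sup>2 * c / 2 + a * b * c + (max 0 (a - b)) ^ 3 / 27 \<le> s ^ 3 * (2 / 25)"
    unfolding abc[symmetric] max by simp
  then show ?thesis using g by (simp add: s_def)
qed

text \<open>
  Since \<open>2 u v \<le> u\<^sup>2 + v\<^sup>2\<close>, the left-hand side is at most \<open>u v w\<close> with \<open>w = a - b - u - v\<close>, and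
  the inequality of arithmetic and geometric means applies to \<open>u\<close>, \<open>v\<close>, \<open>w\<close>, whose sum is \<open>a - b\<close>.
\<close>
lemma sparse_gain_le:
  fixes a b u v :: real
  assumes "0 \<le> u" "0 \<le> v" "0 \<le> b"
  shows "u * v * (a - u - v) - b * (u\<^sup>2 + v\<^sup>2) / 2 \<le> (max 0 (a - b)) ^ 3 / 27"
proof -
  have "b * (2 * u * v) \<le> b * (u\<^sup>2 + v\<^sup>2)" 
    using sum_squares_bound[of u v] \<open>0 \<le> b\<close> by (intro mult_left_mono) auto
  then have 1: "u * v * (a - u - v) - b * (u\<^sup>2 + v\<^sup>2) / 2 \<le> u * v * (a - b - u - v)"
    by (simp add: algebra_simps)
  show ?thesis
  proof (cases "u + v \<le> a - b")
    case False
    then have "u * v * (a - b - u - v) \<le> 0" using assms by (intro mult_nonneg_nonpos) auto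
    then show ?thesis using 1 by (smt (verit) divide_nonneg_pos zero_le_power)
  next
    case True
    define w where "w = a - b - u - v"
    have w: "0 \<le> w" using True by (simp add: w_def)
    \<comment> \<open>The inequality of the means for three numbers, as an identity with nonnegative terms.\<close>
    have "2 * (u + v + w) ^ 3 - 54 * (u * v * w)
       = (u + v + w) * ((u - v)\<^sup>2 + (v - w)\<^sup>2 + (u - w)\<^sup>2)
         + 6 * (u * (v - w)\<^sup>2 + v * (u - w)\<^sup>2 + w * (u - v)\<^sup>2)"
      by (simp add: power2_eq_square power3_eq_cube algebra_simps)
    also have "\<dots> \<ge> 0" using assms w by simp
    finally have "27 * (u * v * w) \<le> (u + v + w) ^ 3" by simp
    moreover have "u + v + w = max 0 (a - b)" using True assms by (simp add: w_def)
    ultimately show ?thesis using 1 unfolding w_def by simp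
  qed
qed

section \<open>A graph that is dense globally but not locally\<close>

lemma edge_sum_augmented_pattern_le:
  fixes x :: "'a \<Rightarrow> nat"
  assumes fin: "finite A" "finite B" "finite C" and A2: "2 \<le> card A"
    and disj: "A \<inter> B = {}" "A \<inter> C = {}" "B \<inter> C = {}"
    and E: "E \<subseteq> nsets A 3" "locally_sparse m E"
    and xm: "sum x (A \<union> B \<union> C) \<le> m"
  shows "real (edge_sum (E \<union> pattern A B C) x) \<le> 2 / 25 * real (sum x (A \<union> B \<union> C)) ^ 3"
proof -
  obtain u v where uv: "u \<in> A" "v \<in> A" "u \<noteq> v"
    and u: "\<And>z. z \<in> A \<Longrightarrow> x z \<le> x u" and v: "\<And>z. z \<in> A - {u} \<Longrightarrow> x z \<le> x v"
    using two_heaviest[OF fin(1) A2, of x] by metis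
  define a b c where "a = real (sum x A)" and "b = real (sum x B)" and "c = real (sum x C)"
  define y where "y = (\<lambda>v. real (x v))"
  have sums: "sum y A = a" "sum y B = b" "sum y C = c" by (simp_all add: a_def b_def c_def y_def)
  have total: "sum x (A \<union> B \<union> C) = sum x A + sum x B + sum x C"
    using fin disj by (simp add: sum.union_disjoint Int_Un_distrib2)
  have nn: "0 \<le> a" "0 \<le> b" "0 \<le> c" by (simp_all only: a_def b_def c_def of_nat_0_le_iff)
  have "sum x A = sum x (A - {u, v}) + sum x {u, v}"
    using uv fin by (intro sum.subset_diff) auto
  then have rest: "real (sum x (A - {u, v})) = a - y u - y v" using uv by (simp add: a_def y_def)
  have "edge_sum E x \<le> x u * x v * sum x (A - {u, v})"
    using total xm by (intro edge_sum_locally_sparse_le[OF E fin(1) _ uv u v]) auto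
  then have "real (edge_sum E x) \<le> real (x u * x v * sum x (A - {u, v}))" by (simp only: of_nat_le_iff)
  then have sp: "edge_sum E y \<le> y u * y v * (a - y u - y v)"
    unfolding of_nat_edge_sum of_nat_mult rest by (simp add: y_def)
  have "(\<Sum>z\<in>{u, v}. (y z)\<^sup>2) \<le> (\<Sum>z\<in>A. (y z)\<^sup>2)" using uv fin by (intro sum_mono2) auto
  then have sq: "(y u)\<^sup>2 + (y v)\<^sup>2 \<le> (\<Sum>z\<in>A. (y z)\<^sup>2)" using uv by simp
  define g where "g = y u * y v * (a - y u - y v) - b * ((y u)\<^sup>2 + (y v)\<^sup>2) / 2"
  have g: "g \<le> (max 0 (a - b)) ^ 3 / 27"
    unfolding g_def by (rule sparse_gain_le) (auto simp: y_def nn)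
  have "real (edge_sum (E \<union> pattern A B C) x) = edge_sum (E \<union> pattern A B C) y"
    by (simp add: of_nat_edge_sum y_def)
  also have "\<dots> = edge_sum E y + (a\<^sup>2 - (\<Sum>z\<in>A. (y z)\<^sup>2)) / 2 * b + a * b * c
      + (b\<^sup>2 - (\<Sum>z\<in>B. (y z)\<^sup>2)) / 2 * c"
    unfolding edge_sum_pattern[OF fin disj E(1)] sums ..
  also have "\<dots> \<le> y u * y v * (a - y u - y v) + (a\<^sup>2 - ((y u)\<^sup>2 + (y v)\<^sup>2)) / 2 * b + a * b * c
      + b\<^sup>2 / 2 * c"
    using sp sq nn by (intro add_mono mult_right_mono divide_right_mono) (auto intro: sum_nonneg)
  also have "\<dots> = a\<^sup>2 * b / 2 + b\<^sup>2 * c / 2 + a * b * c + g"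
    by (simp add: g_def field_simps)
  also have "\<dots> \<le> 2 / 25 * (a + b + c) ^ 3" by (rule pattern_poly_le[OF nn g])
  finally show ?thesis by (simp add: total a_def b_def c_def)
qed

text \<open>
  With parts of sizes \<open>2k\<close>, \<open>2k\<close>, \<open>k\<close> the pattern has \<open>10 k\<^sup>3 - 3 k\<^sup>2\<close> edges, where \<open>10 k\<^sup>3\<close> is
  \<open>(2/25) (5k)\<^sup>3\<close>. The sparse system inside the first part adds \<open>4 k\<^sup>2\<close> edges, more than the deficit.
\<close>
lemma dense_graph_with_small_local_edge_sums:
  "\<exists>N>0. \<exists>F \<subseteq> nsets {..<N::nat} 3. 2 / 25 * real N ^ 3 < card F \<and>
     (\<forall>x :: nat \<Rightarrow> nat. sum x {..<N} \<le> m \<longrightarrow>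
        real (edge_sum F x) \<le> 2 / 25 * real (sum x {..<N}) ^ 3)"
proof -
  obtain n0 where n0: "\<And>n. n0 \<le> n \<Longrightarrow>
      \<exists>E \<subseteq> nsets {..<n} 3. locally_sparse m E \<and> 1 * real (n\<^sup>2) \<le> card E"
    using sparse_triples_exist[of 1 m] by auto
  define k where "k = n0 + 1"
  obtain E where E: "E \<subseteq> nsets {..<2 * k} 3" "locally_sparse m E" "real ((2 * k)\<^sup>2) \<le> card E"
    using n0[of "2 * k"] by (auto simp: k_def)
  define A B C where "A = {..<2 * k}" and "B = {2 * k..<4 * k}" and "C = {4 * k..<5 * k}"
  have fin: "finite A" "finite B" "finite C" by (simp_all add: A_def B_def C_def)
  have disj: "A \<inter> B = {}" "A \<inter> C = {}" "B \<inter> C = {}" by (auto simp: A_def B_def C_def)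
  have V: "A \<union> B \<union> C = {..<5 * k}" by (auto simp: A_def B_def C_def)
  have EA: "E \<subseteq> nsets A 3" using E by (simp add: A_def)
  define F where "F = E \<union> pattern A B C"
  have "F \<subseteq> nsets {..<5 * k} 3"
    unfolding F_def V[symmetric]
    using pattern_subset_nsets[OF disj] subset_trans[OF EA nsets_mono] by (simp add: Un_assoc)
  moreover have "2 / 25 * real (5 * k) ^ 3 < card F"
  proof -
    have "real (card F) = edge_sum F (\<lambda>_. 1)" by (simp add: edge_sum_def)
    also have "\<dots> = card E + (4 * (real k)\<^sup>2 - 2 * k) / 2 * (2 * k) + 2 * k * (2 * k) * real k
        + (4 * (real k)\<^sup>2 - 2 * k) / 2 * k"
      unfolding F_def edge_sum_pattern[OF fin disj EA]
      by (simp add: edge_sum_def A_def B_def C_def power2_eq_square)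
    also have "\<dots> = card E + 10 * real k ^ 3 - 3 * (real k)\<^sup>2"
      by (simp add: power2_eq_square power3_eq_cube field_simps)
    also have "\<dots> > 10 * real k ^ 3"
    proof -
      have "4 * (real k)\<^sup>2 \<le> card E" using E(3) by (simp add: power_mult_distrib)
      moreover have "0 < (real k)\<^sup>2" by (simp add: k_def)
      ultimately show ?thesis by linarith
    qed
    finally show ?thesis by (simp add: power_mult_distrib)
  qed
  moreover have "real (edge_sum F x) \<le> 2 / 25 * real (sum x {..<5 * k}) ^ 3"
    if "sum x {..<5 * k} \<le> m" for x
    using edge_sum_augmented_pattern_le[OF fin _ disj EA E(2), of x] that
    unfolding V F_def by (simp add: A_def k_def)
  ultimately show ?thesis by (intro exI[of _ "5 * k"]) (auto simp: k_def)
qed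

section \<open>Blow-ups and the criterion for non-jumps\<close>

text \<open>
  The edges lifted from \<open>f\<close> arise by choosing a point of \<open>S\<close> in the fibre over every vertex of \<open>f\<close>.
  With \<open>S\<close> the whole vertex set of a blow-up this counts its edges, and with smaller \<open>S\<close> it bounds
  the number of edges of a subgraph.
\<close>
lemma card_lifted_edges:
  assumes S: "finite S" and F: "finite F" "\<And>f. f \<in> F \<Longrightarrow> finite f"
  shows "card {e. e \<subseteq> S \<and> inj_on \<pi> e \<and> \<pi> ` e \<in> F} = edge_sum F (\<lambda>v. card {i \<in> S. \<pi> i = v})"
proof -
  define fib where "fib v = {i \<in> S. \<pi> i = v}" for v
  have one: "card {e. e \<subseteq> S \<and> inj_on \<pi> e \<and> \<pi> ` e = f} = (\<Prod>v\<in>f. card (fib v))" if f: "f \<in> F" for f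
  proof -
    have "bij_betw (\<lambda>g. g ` f) (PiE f fib) {e. e \<subseteq> S \<and> inj_on \<pi> e \<and> \<pi> ` e = f}"
    proof (rule bij_betw_byWitness[where f' = "\<lambda>e. restrict (the_inv_into e \<pi>) f"])
      show "\<forall>g\<in>PiE f fib. restrict (the_inv_into (g ` f) \<pi>) f = g"
      proof
        fix g assume g: "g \<in> PiE f fib"
        then have pg: "\<pi> (g v) = v" if "v \<in> f" for v using that by (auto simp: fib_def PiE_iff)
        then have inj: "inj_on \<pi> (g ` f)" by (auto simp: inj_on_def)
        show "restrict (the_inv_into (g ` f) \<pi>) f = g"
        proof
          fix v show "restrict (the_inv_into (g ` f) \<pi>) f v = g v"
          proof (cases "v \<in> f")
            case True
            then show ?thesis using the_inv_into_f_eq[OF inj pg[OF True]] by simp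
          next
            case False then show ?thesis using g by (auto simp: PiE_iff extensional_def)
          qed
        qed
      qed
      show "\<forall>e\<in>{e. e \<subseteq> S \<and> inj_on \<pi> e \<and> \<pi> ` e = f}. restrict (the_inv_into e \<pi>) f ` f = e"
        by (auto simp: the_inv_into_f_f image_iff)
      show "(\<lambda>g. g ` f) ` PiE f fib \<subseteq> {e. e \<subseteq> S \<and> inj_on \<pi> e \<and> \<pi> ` e = f}"
      proof
        fix e assume "e \<in> (\<lambda>g. g ` f) ` PiE f fib"
        then obtain g where e: "e = g ` f" and g: "g \<in> PiE f fib" by blast
        then have "\<pi> (g v) = v" "g v \<in> S" if "v \<in> f" for v using that by (auto simp: fib_def PiE_iff)
        then show "e \<in> {e. e \<subseteq> S \<and> inj_on \<pi> e \<and> \<pi> ` e = f}"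
          unfolding e by (auto simp: inj_on_def image_image)
      qed
      show "(\<lambda>e. restrict (the_inv_into e \<pi>) f) ` {e. e \<subseteq> S \<and> inj_on \<pi> e \<and> \<pi> ` e = f} \<subseteq> PiE f fib"
      proof
        fix g assume "g \<in> (\<lambda>e. restrict (the_inv_into e \<pi>) f) ` {e. e \<subseteq> S \<and> inj_on \<pi> e \<and> \<pi> ` e = f}"
        then obtain e where g: "g = restrict (the_inv_into e \<pi>) f"
          and e: "e \<subseteq> S" "inj_on \<pi> e" "\<pi> ` e = f" by blast
        have "the_inv_into e \<pi> v \<in> fib v" if "v \<in> f" for v
          using that e f_the_inv_into_f[OF e(2), of v] the_inv_into_into[OF e(2), of v S]
          by (auto simp: fib_def)
        then show "g \<in> PiE f fib" by (simp add: g)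
      qed
    qed
    then have "card (PiE f fib) = card {e. e \<subseteq> S \<and> inj_on \<pi> e \<and> \<pi> ` e = f}"
      by (rule bij_betw_same_card)
    then show ?thesis using card_PiE[OF F(2)[OF f], of fib] by simp
  qed
  have "{e. e \<subseteq> S \<and> inj_on \<pi> e \<and> \<pi> ` e \<in> F} = (\<Union>f\<in>F. {e. e \<subseteq> S \<and> inj_on \<pi> e \<and> \<pi> ` e = f})"
    by auto
  also have "card \<dots> = (\<Sum>f\<in>F. card {e. e \<subseteq> S \<and> inj_on \<pi> e \<and> \<pi> ` e = f})"
  proof (rule card_UN_disjoint)
    show "\<forall>f\<in>F. finite {e. e \<subseteq> S \<and> inj_on \<pi> e \<and> \<pi> ` e = f}"
      using S by (auto intro: finite_subset[of _ "Pow S"])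
  qed (use F in auto)
  finally show ?thesis using one by (simp add: edge_sum_def fib_def)
qed

lemma card_residue_class:
  assumes "v < N"
  shows "card {i \<in> {..<N * q}. i mod N = v} = q"
proof -
  have "{i \<in> {..<N * q}. i mod N = v} = (\<lambda>j. v + N * j) ` {..<q}"
  proof (intro set_eqI iffI)
    fix i assume i: "i \<in> {i \<in> {..<N * q}. i mod N = v}"
    then have "i = v + N * (i div N)" using mod_mult_div_eq[of i N] by simp
    moreover have "i div N < q" using i by (simp add: less_mult_imp_div_less mult.commute)
    ultimately show "i \<in> (\<lambda>j. v + N * j) ` {..<q}" by blast
  next
    fix i assume "i \<in> (\<lambda>j. v + N * j) ` {..<q}"
    then obtain j where j: "i = v + N * j" "j < q" by auto
    have "v + N * j < N + N * j" using assms by simp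
    also have "\<dots> = N * Suc j" by simp
    also have "\<dots> \<le> N * q" using j by (intro mult_le_mono2) auto
    finally show "i \<in> {i \<in> {..<N * q}. i mod N = v}" using j assms by simp
  qed
  moreover have "inj_on (\<lambda>j. v + N * j) {..<q}" using assms by (auto simp: inj_on_def)
  ultimately show ?thesis by (simp add: card_image)
qed

text \<open>
  The blow-up has the vertices \<open>{..<N * q}\<close>, with \<open>i\<close> a copy of \<open>i mod N\<close>. Its density is at least
  \<open>6 * card F / N\<^sup>3\<close> for every \<open>q\<close>, so the excess \<open>\<epsilon>\<close> over \<open>\<alpha>\<close> can be fixed before the threshold \<open>n0\<close>
  is known. The order \<open>m\<close> of the subgraph is taken so large that density \<open>\<alpha> + c\<close> on \<open>m\<close>
  vertices already means more than \<open>(\<alpha>/6) m\<^sup>3\<close> edges, although \<open>m choose 3\<close> is less than \<open>m\<^sup>3 / 6\<close>.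
\<close>
lemma not_jump_3_criterion:
  fixes \<alpha> :: real
  assumes dense: "\<And>m. \<exists>N>0. \<exists>F \<subseteq> nsets {..<N::nat} 3. \<alpha> / 6 * real N ^ 3 < card F \<and>
     (\<forall>x :: nat \<Rightarrow> nat. sum x {..<N} \<le> m \<longrightarrow>
        real (edge_sum F x) \<le> \<alpha> / 6 * real (sum x {..<N}) ^ 3)"
  shows "\<not> jump 3 \<alpha>"
proof
  assume "jump 3 \<alpha>"
  then obtain c where \<alpha>: "0 \<le> \<alpha>" and c: "c > 0"
    and jump: "\<And>\<epsilon> m. \<epsilon> > 0 \<Longrightarrow> 3 \<le> m \<Longrightarrow> \<exists>n0. \<forall>G :: nat hypergraph.
        uniform_graph 3 G \<and> card (verts G) > n0 \<and> density 3 G \<ge> \<alpha> + \<epsilon> \<longrightarrow>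
        (\<exists>H. subgraph 3 H G \<and> card (verts H) = m \<and> density 3 H \<ge> \<alpha> + c)"
    unfolding jump_def by blast
  define m where "m = nat \<lceil>3 * (\<alpha> + c) / c\<rceil> + 3"
  have m3: "3 \<le> m" by (simp add: m_def)
  have big: "\<alpha> / 6 * real m ^ 3 < (\<alpha> + c) * (m choose 3)"
  proof -
    have "3 * (\<alpha> + c) / c \<le> m" unfolding m_def by linarith
    then have "3 * (\<alpha> + c) \<le> m * c" using c by (simp add: pos_divide_le_eq)
    then have "3 * (\<alpha> + c) * m \<le> m * c * m" by (intro mult_right_mono) auto
    then have "\<alpha> * (m * real m) < (\<alpha> + c) * ((real m - 1) * (real m - 2))"
      using \<alpha> c by (simp add: algebra_simps)
    then have "m * (\<alpha> * (m * real m)) < m * ((\<alpha> + c) * ((real m - 1) * (real m - 2)))"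
      using m3 by (intro mult_strict_left_mono) auto
    then show ?thesis unfolding real_choose_3 by (simp add: power3_eq_cube mult_ac)
  qed
  obtain N F where N: "0 < N" and F: "F \<subseteq> nsets {..<N} 3" and large: "\<alpha> / 6 * real N ^ 3 < card F"
    and local: "\<And>x :: nat \<Rightarrow> nat. sum x {..<N} \<le> m \<Longrightarrow>
        real (edge_sum F x) \<le> \<alpha> / 6 * real (sum x {..<N}) ^ 3"
    using dense[of m] by blast
  have finF: "finite F" using F finite_imp_finite_nsets finite_subset by (metis finite_lessThan)
  have edge: "f \<subseteq> {..<N}" "finite f" "card f = 3" if "f \<in> F" for f
    using that F by (auto simp: nsets_def)
  define lifted where "lifted S = {e. e \<subseteq> S \<and> inj_on (\<lambda>i. i mod N) e \<and> (\<lambda>i. i mod N) ` e \<in> F}" for S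
  have lifted: "card (lifted S) = edge_sum F (\<lambda>v. card {i \<in> S. i mod N = v})" if "finite S" for S
    unfolding lifted_def using that finF edge(2) by (rule card_lifted_edges)
  define \<epsilon> where "\<epsilon> = 6 * card F / real N ^ 3 - \<alpha>"
  have "\<epsilon> > 0" using large N by (simp add: \<epsilon>_def field_simps)
  then obtain n0 where n0: "\<And>G :: nat hypergraph. uniform_graph 3 G \<Longrightarrow> card (verts G) > n0 \<Longrightarrow>
      density 3 G \<ge> \<alpha> + \<epsilon> \<Longrightarrow> \<exists>H. subgraph 3 H G \<and> card (verts H) = m \<and> density 3 H \<ge> \<alpha> + c"
    using jump[OF _ m3] by blast
  \<comment> \<open>The summand 3 keeps \<open>N * q choose 3\<close> positive, so that the density is a genuine quotient.\<close>
  define q where "q = n0 + 3"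
  define G where "G = \<lparr>verts = {..<N * q}, edges = lifted {..<N * q}\<rparr>"
  have "q \<le> N * q" using N by simp
  then have nq: "3 \<le> N * q" "n0 < N * q" unfolding q_def by linarith+
  have "uniform_graph 3 G"
    using edge(3) by (auto simp: uniform_graph_def G_def lifted_def card_image[symmetric])
  moreover have "card (verts G) > n0" using nq by (simp add: G_def)
  moreover have "density 3 G \<ge> \<alpha> + \<epsilon>"
  proof -
    have "card (edges G) = edge_sum F (\<lambda>v. card {i \<in> {..<N * q}. i mod N = v})"
      by (simp add: G_def lifted)
    also have "\<dots> = (\<Sum>f\<in>F. q ^ 3)" unfolding edge_sum_def
    proof (rule sum.cong)
      fix f assume f: "f \<in> F"
      then have "(\<Prod>v\<in>f. card {i \<in> {..<N * q}. i mod N = v}) = (\<Prod>v\<in>f. q)"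
        using edge(1)[OF f] by (intro prod.cong refl card_residue_class) auto
      then show "(\<Prod>v\<in>f. card {i \<in> {..<N * q}. i mod N = v}) = q ^ 3" using edge(3)[OF f] by simp
    qed simp
    finally have eG: "card (edges G) = card F * q ^ 3" by simp
    define T where "T = real ((N * q) choose 3)"
    have T: "0 < T" using nq by (simp add: T_def zero_less_binomial)
    have "T = real (N * q) * ((real (N * q) - 1) * (real (N * q) - 2)) / 6"
      unfolding T_def real_choose_3 by simp
    also have "\<dots> \<le> real (N * q) * (real (N * q) * real (N * q)) / 6"
      using nq(1) by (intro divide_right_mono mult_left_mono mult_mono) (auto simp del: of_nat_mult)
    also have "\<dots> = (real N * real q) ^ 3 / 6" by (simp add: power3_eq_cube)
    finally have "card F * (6 * T) \<le> card F * (real N * real q) ^ 3" by (intro mult_left_mono) auto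
    then have "6 * card F / real N ^ 3 \<le> card F * real q ^ 3 / T"
      using T N by (simp add: field_simps power_mult_distrib)
    then show ?thesis by (simp add: \<epsilon>_def density_def eG T_def[symmetric]) (simp add: G_def T_def)
  qed
  ultimately obtain H where H: "subgraph 3 H G" "card (verts H) = m" "density 3 H \<ge> \<alpha> + c"
    using n0 by blast
  have finH: "finite (verts H)" using H by (auto simp: subgraph_def uniform_graph_def)
  define x where "x v = card {i \<in> verts H. i mod N = v}" for v
  have "edges H \<subseteq> lifted (verts H)"
    using H by (auto simp: subgraph_def uniform_graph_def G_def lifted_def)
  then have "card (edges H) \<le> card (lifted (verts H))"
    using finH by (intro card_mono) (auto simp: lifted_def intro: finite_subset[of _ "Pow (verts H)"])
  then have le: "real (card (edges H)) \<le> real (edge_sum F x)" using lifted[OF finH] by (simp add: x_def[abs_def])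
  have "sum x {..<N} = (\<Sum>v<N. \<Sum>i\<in>{i \<in> verts H. i mod N = v}. 1)" by (simp add: x_def)
  also have "\<dots> = (\<Sum>i\<in>verts H. 1)" using finH N by (intro sum.group) auto
  finally have "sum x {..<N} = m" using H by simp
  then have "real (card (edges H)) \<le> \<alpha> / 6 * real m ^ 3" using local[of x] le by simp
  moreover have "(\<alpha> + c) * (m choose 3) \<le> card (edges H)"
    using H m3 by (simp add: density_def pos_le_divide_eq zero_less_binomial)
  ultimately show False using big by linarith
qed

theorem theorem1p2:
  shows "\<not> jump 3 (12 / 25)"
proof (rule not_jump_3_criterion)
  fix m
  show "\<exists>N>0. \<exists>F \<subseteq> nsets {..<N::nat} 3. 12 / 25 / 6 * real N ^ 3 < card F \<and>
     (\<forall>x :: nat \<Rightarrow> nat. sum x {..<N} \<le> m \<longrightarrow>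
        real (edge_sum F x) \<le> 12 / 25 / 6 * real (sum x {..<N}) ^ 3)"
    using dense_graph_with_small_local_edge_sums[of m] by simp
qed
end
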